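(* For every odd prime number $p$, the Chebyshev polynomial of the second kind $U_p(x)$, the Morgan-Voyce polynomial (of Fibonacci type) $B_p(x)$ and the Vieta polynomial $V_p(x)$ are reducible over $\mathbb{Q}$, i.e. each is a product of two non-constant polynomials in $\mathbb{Q}[x]$.
   Context: The polynomial sequences are defined, with the following indexing, for $n\ge 2$ by: Chebyshev second kind: $U_0=0$, $U_1=1$, $U_n(x)=2xU_{n-1}(x)-U_{n-2}(x)$; Morgan-Voyce (Fibonacci type): $B_0=0$, $B_1=1$, $B_n(x)=(x+2)B_{n-1}(x)-B_{n-2}(x)$; Vieta: $V_0=0$, $V_1=1$, $V_n(x)=xV_{n-1}(x)-V_{n-2}(x)$. *)

theory Defs
  imports "HOL-Computational_Algebra.Computational_Algebra"
begin

(* In pCons notation, [:0, 2:] is 2x, [:2, 1:] is x + 2 and [:0, 1:] is x. *)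

fun chebyshev_U :: "nat \<Rightarrow> rat poly" where
  "chebyshev_U 0 = 0"
| "chebyshev_U (Suc 0) = 1"
| "chebyshev_U (Suc (Suc n)) = [:0, 2:] * chebyshev_U (Suc n) - chebyshev_U n"

fun morgan_voyce_B :: "nat \<Rightarrow> rat poly" where
  "morgan_voyce_B 0 = 0"
| "morgan_voyce_B (Suc 0) = 1"
| "morgan_voyce_B (Suc (Suc n)) = [:2, 1:] * morgan_voyce_B (Suc n) - morgan_voyce_B n"

fun vieta_V :: "nat \<Rightarrow> rat poly" where
  "vieta_V 0 = 0"
| "vieta_V (Suc 0) = 1"
| "vieta_V (Suc (Suc n)) = [:0, 1:] * vieta_V (Suc n) - vieta_V n"

(* Not the negation of the library's irreducible, which also holds of 0 and of the units. *)
definition reducible_poly :: "rat poly \<Rightarrow> bool" where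
  "reducible_poly f \<longleftrightarrow> (\<exists>g h. f = g * h \<and> degree g > 0 \<and> degree h > 0)"

end

(* The polynomials satisfy W(m+n+1) = W(m+1) W(n+1) - W(m) W(n). Taking m = n makes the right-hand
   side a difference of squares, so W(2m+1) = (W(m+1) - W(m)) (W(m+1) + W(m)), where both factors
   have the degree m of W(m+1) because W(m) has smaller degree. *)
theory Submission
  imports Defs
begin

text \<open>Induction on \<open>m\<close> shifts one unit of the index from \<open>m\<close> to
  \<open>n\<close>: expanding \<open>W (Suc (Suc n))\<close> or \<open>W (Suc (Suc m))\<close>
  produces the same term \<open>a * W (Suc m) * W (Suc n)\<close>. Hence \<open>n\<close> must be
  arbitrary.\<close>

lemma recurrence_add:
  fixes W :: "nat \<Rightarrow> 'a::comm_ring_1"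
  assumes "W 0 = 0" and "W (Suc 0) = 1"
    and rec: "\<And>n. W (Suc (Suc n)) = a * W (Suc n) - W n"
  shows "W (Suc (m + n)) = W (Suc m) * W (Suc n) - W m * W n"
proof (induction m arbitrary: n)
  case 0
  show ?case using assms by simp
next
  case (Suc m)
  have "W (Suc (Suc m + n)) = W (Suc (m + Suc n))" by simp
  also have "\<dots> = W (Suc m) * W (Suc (Suc n)) - W m * W (Suc n)" by (rule Suc)
  also have "\<dots> = W (Suc (Suc m)) * W (Suc n) - W (Suc m) * W n"
    by (simp add: rec algebra_simps)
  finally show ?case .
qed

text \<open>The recurrence has order two, so the induction carries the degrees of two consecutive
  terms. Truncated subtraction makes \<open>n - 1\<close> correct also for \<open>W 0 = 0\<close>,
  whose degree is 0 by convention.\<close>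

lemma recurrence_degree:
  fixes W :: "nat \<Rightarrow> 'a::idom poly"
  assumes "W 0 = 0" and "W (Suc 0) = 1"
    and rec: "\<And>n. W (Suc (Suc n)) = a * W (Suc n) - W n"
    and "degree a = 1"
  shows "W (Suc n) \<noteq> 0 \<and> degree (W (Suc n)) = n \<and> degree (W n) = n - 1"
proof (induction n)
  case 0
  show ?case using assms by simp
next
  case (Suc n)
  have "a \<noteq> 0" using \<open>degree a = 1\<close> by auto
  then have "degree (a * W (Suc n)) = Suc n"
    using Suc \<open>degree a = 1\<close> by (simp add: degree_mult_eq)
  moreover from this have "degree (W n) < degree (a * W (Suc n))"
    using Suc by simp
  \<comment> \<open>\<open>W n\<close> has too small a degree to cancel the leading term of the
    product.\<close>
  ultimately have "degree (W (Suc (Suc n))) = Suc n"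
    using degree_add_eq_left[of "- W n" "a * W (Suc n)"] by (simp add: rec)
  then show ?case using Suc by auto
qed

text \<open>Keeping the linear coefficient \<open>a\<close> abstract covers all three families at
  once, with \<open>a\<close> equal to 2x, x + 2 or x.\<close>

lemma recurrence_reducible:
  fixes W :: "nat \<Rightarrow> rat poly"
  assumes W: "W 0 = 0" "W (Suc 0) = 1"
      "\<And>n. W (Suc (Suc n)) = a * W (Suc n) - W n"
    and a: "degree a = 1"
    and "odd k" and "k \<noteq> 1"
  shows "reducible_poly (W k)"
proof -
  obtain m where k: "k = Suc (m + m)"
    using \<open>odd k\<close> by (auto elim!: oddE simp: mult_2)
  \<comment> \<open>For \<open>m = 0\<close> both factors would be the constant 1;
    \<open>m > 0\<close> also makes \<open>m - 1 < m\<close>, so that \<open>W m\<close> has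
    strictly smaller degree than \<open>W (Suc m)\<close>.\<close>
  with \<open>k \<noteq> 1\<close> have "m > 0" by simp
  have deg: "degree (W (Suc m)) = m" "degree (W m) < m"
    using recurrence_degree[of W a m, OF W a] \<open>m > 0\<close> by auto
  have "W k = (W (Suc m) - W m) * (W (Suc m) + W m)"
    unfolding k using recurrence_add[of W a m m, OF W] by (simp add: algebra_simps)
  moreover have "degree (W (Suc m) + W m) = m"
    using degree_add_eq_left[of "W m" "W (Suc m)"] deg by simp
  moreover have "degree (W (Suc m) - W m) = m"
    using degree_add_eq_left[of "- W m" "W (Suc m)"] deg by simp
  ultimately show ?thesis
    unfolding reducible_poly_def using \<open>m > 0\<close> by metis
qed

theorem mainTheorem9:
  fixes p :: nat
  assumes "prime p" and "odd p"
  shows "reducible_poly (chebyshev_U p) \<and> reducible_poly (morgan_voyce_B p) \<and> reducible_poly (vieta_V p)"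
proof (intro conjI)
  have "p \<noteq> 1" using \<open>prime p\<close> by auto
  show "reducible_poly (chebyshev_U p)"
    by (rule recurrence_reducible[of _ "[:0, 2:]"]) (use \<open>odd p\<close> \<open>p \<noteq> 1\<close> in simp_all)
  show "reducible_poly (morgan_voyce_B p)"
    by (rule recurrence_reducible[of _ "[:2, 1:]"]) (use \<open>odd p\<close> \<open>p \<noteq> 1\<close> in simp_all)
  show "reducible_poly (vieta_V p)"
    by (rule recurrence_reducible[of _ "[:0, 1:]"]) (use \<open>odd p\<close> \<open>p \<noteq> 1\<close> in simp_all)
qed

end
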